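(* Let $C$ be a graph of colors and let $(\Delta_i)_{i\in V(C)}$ be data for symmetry-restricted graphs over $C$ (finite permutation groups whose orbits are indexed by the edge-colors departing $i$). For each edge-color $k\in E(C)$ let $\Delta_k\le\Delta_{\partial_0 k}$ be the stabilizer of a point in the orbit of $\Delta_{\partial_0 k}$ indexed by $k$. Suppose that for every closed directed path $(k_1,k_2,\dots,k_r)$ in $C$ there is an isomorphism of groups $$\prod_{i=1}^r\Delta_{k_i}\cong\prod_{i=1}^r\Delta_{\bar k_i}.$$ Then any two finite symmetry-restricted graphs for these data which have a common covering (a symmetry-restricted graph for these data, possibly infinite, with morphisms of symmetry-restricted graphs to both) have a common finite covering (a finite symmetry-restricted graph for these data with morphisms of symmetry-restricted graphs to both).
   Context: All graphs are connected. Combinatorially, a graph $G$ consists of a vertex set $V(G)$, a directed edge set $E(G)$, an involution $e\mapsto\bar e$ on $E(G)$, and maps $\partial_0,\partial_1\colon E(G)\to V(G)$ (tail and head) with $\partial_0\bar e=\partial_1 e$. In an ordinary graph $e\ne\bar e$; a graph of colors may also have edges with $k=\bar k$. A graph-homomorphism commutes with $\partial_0,\partial_1$ and the involution. A closed directed path in $C$ is a sequence $(k_1,\dots,k_r)$ of directed edges with $\partial_1 k_j=\partial_0 k_{j+1}$ for $1\le j<r$ and $\partial_1k_r=\partial_0k_1$. A $C$-colored graph is a graph with a graph-homomorphism to the graph of colors $C$; homomorphisms of $C$-colored graphs preserve colors. An $i$-vertex is a vertex of color $i\in V(C)$; a $k$-edge is a directed edge of color $k\in E(C)$. For a vertex $v$,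 $\mathrm{star}(v)$ denotes the set of directed edges departing $v$ (edges with tail $v$). Data for symmetry-restricted graphs: a graph of colors $C$ and, for each $i\in V(C)$, a finite permutation group $\Delta_i$ (a finite group acting faithfully on a finite set) together with an indexing of the orbits of $\Delta_i$ by the edge-colors $k\in E(C)$ with $\partial_0 k=i$ (one orbit for each such $k$). The stabilizer $\Delta_k$ is determined up to conjugation in $\Delta_{\partial_0 k}$; a choice is made. A symmetry-restricted graph for these data is a $C$-colored graph $G$ together with, for each $i$-vertex $v$ of $G$ (for every $i$), a representation of $\Delta_i$ as a color-preserving permutation group on $\mathrm{star}(v)$; that is, an action of $\Delta_i$ on $\mathrm{star}(v)$ that is isomorphic, as a $\Delta_i$-set, to the given permutation representation of $\Delta_i$, with the orbit indexed by $k$ corresponding to the set of $k$-edges in $\mathrm{star}(v)$. If $\Delta$ is a group, a map $\phi\colon X\to Y$ of $\Delta$-sets is weakly equivariant if there is $\gamma\in\Delta$ such that $\phi(\delta x)=\gamma\delta\gamma^{-1}\phi(x)$ for all $x\in X$, $\delta\in\Delta$. A morphism $\phi\colon G\to G'$ of symmetry-restricted graphs is a colored graph homomorphism which restricts to a weakly equivariant bijection $\mathrm{star}(v)\to\mathrm{star}(\phi(v))$ for each vertex $v$ of $G$. Every morphism is a covering map, and "covering" of symmetry-restricted graphs means such a morphism. *)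

theory Defs
  imports
    "HOL-Algebra.Group_Action"
    "HOL-Algebra.Product_Groups"
    "Graph_Theory.Graph_Theory"
begin

text \<open>The library's \<open>bidirected_digraph\<close> forces \<open>arev e \<noteq> e\<close> on arcs, which is too strong for graphs
  of colors; hence a separate notion of graph with an involution on its directed edges.
  \<open>tail\<close> and \<open>head\<close> are the maps usually written \<open>\<partial>\<^sub>0\<close> and \<open>\<partial>\<^sub>1\<close>.\<close>

record ('v, 'e) igraph =
  dg :: "('v, 'e) pre_digraph"
  bar :: "'e \<Rightarrow> 'e"

text \<open>\<open>Digraph_Component.connected\<close> includes non-emptiness of the vertex set.\<close>

definition color_graph :: "('v, 'e, 'z) igraph_scheme \<Rightarrow> bool" where
  "color_graph G \<longleftrightarrow>
     wf_digraph (dg G) \<and>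
     (\<forall>e \<in> arcs (dg G). bar G e \<in> arcs (dg G) \<and> bar G (bar G e) = e \<and>
        tail (dg G) (bar G e) = head (dg G) e) \<and>
     Digraph_Component.connected (dg G)"

definition ordinary_graph :: "('v, 'e, 'z) igraph_scheme \<Rightarrow> bool" where
  "ordinary_graph G \<longleftrightarrow> color_graph G \<and> (\<forall>e \<in> arcs (dg G). bar G e \<noteq> e)"

abbreviation star :: "('v, 'e, 'z) igraph_scheme \<Rightarrow> 'v \<Rightarrow> 'e set" where
  "star G v \<equiv> out_arcs (dg G) v"

definition graph_hom ::
  "('v, 'e, 'z) igraph_scheme \<Rightarrow> ('w, 'f, 'y) igraph_scheme \<Rightarrow> ('v \<Rightarrow> 'w) \<Rightarrow> ('e \<Rightarrow> 'f) \<Rightarrow> bool" where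
  "graph_hom G H fv fe \<longleftrightarrow>
     fv ` verts (dg G) \<subseteq> verts (dg H) \<and> fe ` arcs (dg G) \<subseteq> arcs (dg H) \<and>
     (\<forall>e \<in> arcs (dg G).
        tail (dg H) (fe e) = fv (tail (dg G) e) \<and>
        head (dg H) (fe e) = fv (head (dg G) e) \<and>
        fe (bar G e) = bar H (fe e))"

text \<open>For each vertex \<open>i\<close> of the graph of colors: the group \<open>grp D i\<close> acting by \<open>gact D i\<close> on the set
  \<open>pts D i\<close>; \<open>orb D k\<close> is the orbit indexed by the edge-color \<open>k\<close>.\<close>

record ('i, 'k, 'd, 'x) sr_data =
  grp :: "'i \<Rightarrow> 'd monoid"
  pts :: "'i \<Rightarrow> 'x set"
  gact :: "'i \<Rightarrow> 'd \<Rightarrow> 'x \<Rightarrow> 'x"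
  orb :: "'k \<Rightarrow> 'x set"

definition is_sr_data :: "('i, 'k, 'z) igraph_scheme \<Rightarrow> ('i, 'k, 'd, 'x) sr_data \<Rightarrow> bool" where
  "is_sr_data C D \<longleftrightarrow>
     (\<forall>i \<in> verts (dg C).
        faithful_action (grp D i) (pts D i) (gact D i) \<and>
        finite (carrier (grp D i)) \<and> finite (pts D i) \<and>
        bij_betw (orb D) (star C i) (orbits (grp D i) (pts D i) (gact D i)))"

definition stabilizer_choice ::
  "('i, 'k, 'z) igraph_scheme \<Rightarrow> ('i, 'k, 'd, 'x) sr_data \<Rightarrow> ('k \<Rightarrow> 'd set) \<Rightarrow> bool" where
  "stabilizer_choice C D stabs \<longleftrightarrow>
     (\<forall>k \<in> arcs (dg C). \<exists>x \<in> orb D k.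
        stabs k = stabilizer (grp D (tail (dg C) k)) (gact D (tail (dg C) k)) x)"

definition stab_group ::
  "('i, 'k, 'z) igraph_scheme \<Rightarrow> ('i, 'k, 'd, 'x) sr_data \<Rightarrow> ('k \<Rightarrow> 'd set) \<Rightarrow> 'k \<Rightarrow> 'd monoid" where
  "stab_group C D stabs k = (grp D (tail (dg C) k)) \<lparr>carrier := stabs k\<rparr>"

text \<open>A graph with a coloring \<open>(vcol, ecol)\<close> and, at each vertex \<open>v\<close>, a map \<open>sact v\<close> giving the action
  of the group of the color of \<open>v\<close> on the star of \<open>v\<close>.\<close>

record ('v, 'e, 'i, 'k, 'd) sr_graph = "('v, 'e) igraph" +
  vcol :: "'v \<Rightarrow> 'i"
  ecol :: "'e \<Rightarrow> 'k"
  sact :: "'v \<Rightarrow> 'd \<Rightarrow> 'e \<Rightarrow> 'e"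

definition is_sr_graph ::
  "('i, 'k, 'z) igraph_scheme \<Rightarrow> ('i, 'k, 'd, 'x) sr_data \<Rightarrow> ('v, 'e, 'i, 'k, 'd) sr_graph \<Rightarrow> bool" where
  "is_sr_graph C D G \<longleftrightarrow>
     ordinary_graph G \<and>
     graph_hom G C (vcol G) (ecol G) \<and>
     (\<forall>v \<in> verts (dg G).
        group_action (grp D (vcol G v)) (star G v) (sact G v) \<and>
        (\<exists>h. bij_betw h (pts D (vcol G v)) (star G v) \<and>
           (\<forall>\<delta> \<in> carrier (grp D (vcol G v)). \<forall>x \<in> pts D (vcol G v).
              h (gact D (vcol G v) \<delta> x) = sact G v \<delta> (h x)) \<and>
           (\<forall>k \<in> star C (vcol G v). h ` orb D k = {e \<in> star G v. ecol G e = k})))"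

definition weakly_equivariant ::
  "'d monoid \<Rightarrow> 'a set \<Rightarrow> ('d \<Rightarrow> 'a \<Rightarrow> 'a) \<Rightarrow> ('d \<Rightarrow> 'b \<Rightarrow> 'b) \<Rightarrow> ('a \<Rightarrow> 'b) \<Rightarrow> bool" where
  "weakly_equivariant \<Delta> X \<alpha> \<beta> f \<longleftrightarrow>
     (\<exists>\<gamma> \<in> carrier \<Delta>. \<forall>x \<in> X. \<forall>\<delta> \<in> carrier \<Delta>.
        f (\<alpha> \<delta> x) = \<beta> (\<gamma> \<otimes>\<^bsub>\<Delta>\<^esub> \<delta> \<otimes>\<^bsub>\<Delta>\<^esub> inv\<^bsub>\<Delta>\<^esub> \<gamma>) (f x))"

definition sr_morphism ::
  "('i, 'k, 'd, 'x) sr_data \<Rightarrow> ('v, 'e, 'i, 'k, 'd) sr_graph \<Rightarrow> ('w, 'f, 'i, 'k, 'd) sr_graph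
     \<Rightarrow> ('v \<Rightarrow> 'w) \<Rightarrow> ('e \<Rightarrow> 'f) \<Rightarrow> bool" where
  "sr_morphism D G H fv fe \<longleftrightarrow>
     graph_hom G H fv fe \<and>
     (\<forall>v \<in> verts (dg G). vcol H (fv v) = vcol G v) \<and>
     (\<forall>e \<in> arcs (dg G). ecol H (fe e) = ecol G e) \<and>
     (\<forall>v \<in> verts (dg G).
        bij_betw fe (star G v) (star H (fv v)) \<and>
        weakly_equivariant (grp D (vcol G v)) (star G v) (sact G v) (sact H (fv v)) fe)"

definition sr_covers ::
  "('i, 'k, 'd, 'x) sr_data \<Rightarrow> ('v, 'e, 'i, 'k, 'd) sr_graph \<Rightarrow> ('w, 'f, 'i, 'k, 'd) sr_graph \<Rightarrow> bool" where
  "sr_covers D G H \<longleftrightarrow> (\<exists>fv fe. sr_morphism D G H fv fe)"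

end

theory Submission
  imports Defs
begin

text \<open>Over each pair of vertices \<open>(v, v')\<close> of a common color \<open>i\<close> fix one equivariant isomorphism of stars
  \<open>F\<close>. The \<open>|\<Delta>\<^sub>i|\<close> maps \<open>\<delta> \<circ> F\<close> are weakly equivariant, and for \<open>k\<close>-edges \<open>e\<close>, \<open>e'\<close>
  exactly \<open>|\<Delta>\<^sub>k|\<close> of them send \<open>e\<close> to \<open>e'\<close>. Take \<open>m\<^sub>i\<close> copies of each triple \<open>(v, v', \<delta>)\<close> as vertices; then
  \<open>m\<^sub>i |\<Delta>\<^sub>k|\<close> vertices have an edge over \<open>(e, e')\<close>, and these can be joined to the vertices with
  an edge over the reversed pair as soon as \<open>m\<^sub>i |\<Delta>\<^sub>k| = m\<^sub>j |\<Delta>\<^bsub>bar k\<^esub>|\<close> for \<open>k\<close> from \<open>i\<close> to \<open>j\<close>. Such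
  multiplicities exist because the orders of the stabilizers balance along closed paths. A
  component of the resulting graph is a common finite covering. The given common covering only
  serves to provide two vertices of the same color.\<close>

section \<open>Graphs with an involution on the arcs\<close>

text \<open>Connectedness is left out because the fibre product built below may be disconnected;
  only one of its components is a graph in the full sense.\<close>

definition involutive_graph :: "('v, 'e, 'z) igraph_scheme \<Rightarrow> bool" where
  "involutive_graph G \<longleftrightarrow>
     wf_digraph (dg G) \<and>
     (\<forall>e \<in> arcs (dg G). bar G e \<in> arcs (dg G) \<and> bar G (bar G e) = e \<and>
        tail (dg G) (bar G e) = head (dg G) e)"

lemma color_graph_iff:
  "color_graph G \<longleftrightarrow> involutive_graph G \<and> Digraph_Component.connected (dg G)"
  by (auto simp: color_graph_def involutive_graph_def)

lemma involutive_graph_head_bar: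
  "head (dg G) (bar G e) = tail (dg G) e" if "involutive_graph G" "e \<in> arcs (dg G)"
  using that by (metis involutive_graph_def)

lemma involutive_graph_symmetric:
  assumes "involutive_graph G"
  shows "symmetric (dg G)"
  unfolding symmetric_conv
  using assms involutive_graph_head_bar[OF assms] by (metis involutive_graph_def)

lemma graph_hom_comp:
  assumes "graph_hom G H p q" "graph_hom H L p' q'"
  shows "graph_hom G L (p' \<circ> p) (q' \<circ> q)"
  using assms by (auto simp: graph_hom_def image_subset_iff)

section \<open>Reversed walks and multiplicities balanced along arcs\<close>

lemma awalk_reverse:
  assumes "involutive_graph G" "pre_digraph.awalk (dg G) u p v"
  shows "pre_digraph.awalk (dg G) v (map (bar G) (rev p)) u"
proof -
  interpret wf_digraph "dg G" using assms(1) by (simp add: involutive_graph_def)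
  show ?thesis using assms(2)
  proof (induction p arbitrary: u)
    case Nil
    then show ?case by (auto simp: awalk_Nil_iff)
  next
    case (Cons e p)
    from Cons.prems have e: "e \<in> arcs (dg G)" "tail (dg G) e = u" "awalk (head (dg G) e) p v"
      by (auto simp: awalk_Cons_iff)
    have "awalk (head (dg G) e) [bar G e] u"
      using assms(1) e involutive_graph_head_bar[OF assms(1) e(1)]
      by (auto simp: awalk_Cons_iff awalk_Nil_iff involutive_graph_def)
    with Cons.IH[OF e(3)] show ?case by (auto intro: awalk_appendI)
  qed
qed

text \<open>A rational potential with the ratio \<open>w k / w (bar k)\<close> on every arc is well defined because of the
  condition on closed walks; \<open>m\<close> is this potential with denominators cleared.\<close>

lemma balanced_multiplicities:
  fixes w :: "'e \<Rightarrow> nat"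
  assumes C: "color_graph C" and I: "finite I" "I \<subseteq> verts (dg C)"
    and pos: "\<And>k. k \<in> arcs (dg C) \<Longrightarrow> 0 < w k"
    and closed: "\<And>p. wf_digraph.closed_w (dg C) p \<Longrightarrow> (\<Prod>k\<leftarrow>p. w k) = (\<Prod>k\<leftarrow>p. w (bar C k))"
  obtains m :: "'v \<Rightarrow> nat"
    where "\<And>i. i \<in> I \<Longrightarrow> 0 < m i"
      and "\<And>k. \<lbrakk>k \<in> arcs (dg C); tail (dg C) k \<in> I; head (dg C) k \<in> I\<rbrakk>
        \<Longrightarrow> m (tail (dg C) k) * w k = m (head (dg C) k) * w (bar C k)"
proof -
  have inv: "involutive_graph C" using C by (simp add: color_graph_iff)
  interpret wf_digraph "dg C" using inv by (simp add: involutive_graph_def)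
  have "strongly_connected (dg C)"
    using C involutive_graph_symmetric[OF inv]
    by (simp add: color_graph_iff symmetric_connected_imp_strongly_connected)
  then obtain i0 where reach: "\<And>i. i \<in> verts (dg C) \<Longrightarrow> i0 \<rightarrow>\<^sup>*\<^bsub>dg C\<^esub> i"
    unfolding strongly_connected_def by blast
  then obtain P where P: "\<And>i. i \<in> verts (dg C) \<Longrightarrow> awalk i0 (P i) i"
    unfolding reachable_awalk by metis
  \<comment> \<open>The potential at \<open>i\<close> is \<open>a (P i) / b (P i)\<close> for the
    chosen walk \<open>P i\<close> from the base vertex \<open>i0\<close>. Numerator and denominator
    are kept apart in order to stay in the naturals; reversing a walk exchanges them.\<close>
  define a where "a p = (\<Prod>k\<leftarrow>p. w k)" for p
  define b where "b p = (\<Prod>k\<leftarrow>p. w (bar C k))" for p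
  have barbar: "bar C k \<in> arcs (dg C)" "bar C (bar C k) = k" if "k \<in> arcs (dg C)" for k
    using inv that by (auto simp: involutive_graph_def)
  have ab_pos: "0 < a p" "0 < b p" if "set p \<subseteq> arcs (dg C)" for p
    using that by (induction p) (auto simp: a_def b_def pos barbar)
  have a_rev: "a (map (bar C) (rev p)) = b p" for p
    by (induction p) (auto simp: a_def b_def)
  have b_rev: "b (map (bar C) (rev p)) = a p" if "set p \<subseteq> arcs (dg C)" for p
    using that by (induction p) (auto simp: a_def b_def barbar)
  have Parcs: "set (P i) \<subseteq> arcs (dg C)" if "i \<in> verts (dg C)" for i
    using P[OF that] by (auto simp: awalk_def)
  \<comment> \<open>This is the cross-multiplied form of: the potential at the head of
    \<open>k\<close> is the potential at its tail times \<open>w k / w (bar C k)\<close>. The closed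
    walk runs along \<open>P i\<close>, across \<open>k\<close> and back along
    \<open>P j\<close>.\<close>
  have step: "a (P i) * w k * b (P j) = b (P i) * w (bar C k) * a (P j)"
    if k: "k \<in> arcs (dg C)" "i = tail (dg C) k" "j = head (dg C) k" for i j k
  proof -
    have ij: "i \<in> verts (dg C)" "j \<in> verts (dg C)" using k by auto
    have "awalk i [k] j" using k by (auto simp: awalk_Cons_iff awalk_Nil_iff)
    then have "awalk i0 (P i @ [k] @ map (bar C) (rev (P j))) i0"
      using P[OF ij(1)] awalk_reverse[OF inv P[OF ij(2)]] by (blast intro: awalk_appendI)
    then have "closed_w (P i @ [k] @ map (bar C) (rev (P j)))"
      by (auto simp: closed_w_def)
    from closed[OF this] have
      "a (P i @ [k] @ map (bar C) (rev (P j))) = b (P i @ [k] @ map (bar C) (rev (P j)))"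
      by (simp only: a_def b_def)
    moreover have "a (x @ [k] @ y) = a x * w k * a y" "b (x @ [k] @ y) = b x * w (bar C k) * b y"
      for x y by (simp_all add: a_def b_def)
    ultimately show ?thesis by (simp only: a_rev b_rev[OF Parcs[OF ij(2)]])
  qed
  \<comment> \<open>The potential at \<open>i\<close> is multiplied by the product of all
    \<open>b (P j)\<close> with \<open>j\<close> in \<open>I\<close>, and the factor
    \<open>b (P i)\<close> cancels. Since \<open>C\<close> may be infinite, the common denominator
    is formed over the finite set \<open>I\<close> only.\<close>
  define m where "m i = a (P i) * (\<Prod>j\<in>I - {i}. b (P j))" for i
  have mb: "m i * b (P i) = a (P i) * (\<Prod>j\<in>I. b (P j))" if "i \<in> I" for i
    using prod.remove[OF I(1) that, of "\<lambda>j. b (P j)"] by (simp add: m_def)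
  show thesis
  proof
    fix i assume i: "i \<in> I"
    have "0 < a (P j)" "0 < b (P j)" if "j \<in> I" for j
      using that I ab_pos[OF Parcs] by auto
    with i show "0 < m i" unfolding m_def by (intro mult_pos_pos prod_pos) auto
  next
    fix k assume k: "k \<in> arcs (dg C)" "tail (dg C) k \<in> I" "head (dg C) k \<in> I"
    let ?i = "tail (dg C) k" and ?j = "head (dg C) k"
    have nz: "b (P ?i) * b (P ?j) > 0" using k I Parcs ab_pos by auto
    have "m ?i * w k * (b (P ?i) * b (P ?j)) = (m ?i * b (P ?i)) * w k * b (P ?j)"
      by simp
    also have "\<dots> = (\<Prod>j\<in>I. b (P j)) * (a (P ?i) * w k * b (P ?j))"
      by (simp add: mb k)
    also have "\<dots> = (m ?j * b (P ?j)) * w (bar C k) * b (P ?i)"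
      by (simp add: mb k step[OF k(1) refl refl])
    also have "\<dots> = m ?j * w (bar C k) * (b (P ?i) * b (P ?j))"
      by simp
    finally show "m ?i * w k = m ?j * w (bar C k)" using nz by simp
  qed
qed

section \<open>Components, encoded on the naturals\<close>

text \<open>The part of \<open>K\<close> reachable from \<open>x0\<close> contains every arc that
  departs from one of its vertices and is closed under reversal, so its stars are full stars of
  \<open>K\<close>. Finiteness permits renaming vertices and arcs by natural numbers, the type
  required of the final covering.\<close>

lemma finite_component_on_nat:
  fixes K :: "('v, 'e) igraph"
  assumes K: "involutive_graph K" "fin_digraph (dg K)" and x0: "x0 \<in> verts (dg K)"
  obtains L :: "(nat, nat) igraph" and f g
    where "color_graph L" "fin_digraph (dg L)" "graph_hom L K f g"
      "\<And>y. y \<in> verts (dg L) \<Longrightarrow> bij_betw g (star L y) (star K (f y))"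
proof -
  interpret K: fin_digraph "dg K" by fact
  have barK: "bar K e \<in> arcs (dg K)" "bar K (bar K e) = e"
    "tail (dg K) (bar K e) = head (dg K) e" "head (dg K) (bar K e) = tail (dg K) e"
    if "e \<in> arcs (dg K)" for e
    using that K(1) involutive_graph_head_bar[OF K(1)] by (auto simp: involutive_graph_def)
  obtain cv :: "'v \<Rightarrow> nat" where cv: "inj_on cv (verts (dg K))"
    using finite_imp_inj_to_nat_seg[OF K.finite_verts] by blast
  obtain ce :: "'e \<Rightarrow> nat" where ce: "inj_on ce (arcs (dg K))"
    using finite_imp_inj_to_nat_seg[OF K.finite_arcs] by blast
  define R where "R = {y. x0 \<rightarrow>\<^sup>*\<^bsub>dg K\<^esub> y}"
  define A where "A = {e \<in> arcs (dg K). tail (dg K) e \<in> R}"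
  \<comment> \<open>The decoding maps \<open>f\<close> and \<open>g\<close> form the homomorphism
    from the renamed component back to \<open>K\<close>.\<close>
  define f where "f = inv_into (verts (dg K)) cv"
  define g where "g = inv_into (arcs (dg K)) ce"
  have R: "R \<subseteq> verts (dg K)" by (auto simp: R_def K.reachable_in_verts)
  have A: "A \<subseteq> arcs (dg K)" by (auto simp: A_def)
  have f: "f (cv y) = y" if "y \<in> R" for y
    using that R cv by (auto simp: f_def)
  have cv_eq: "cv y = cv z \<longleftrightarrow> y = z" if "y \<in> R" "z \<in> R" for y z
    using f that by metis
  have g: "g (ce e) = e" if "e \<in> A" for e
    using that A ce by (auto simp: g_def)
  have headR: "head (dg K) e \<in> R" if "e \<in> A" for e
    using that unfolding A_def R_def
    by (auto intro: K.reachable_adj_trans K.in_arcs_imp_in_arcs_ends)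
  have barA: "bar K e \<in> A" if "e \<in> A" for e
    using that headR[OF that] by (auto simp: A_def barK)
  define L :: "(nat, nat) igraph" where
    "L = \<lparr>dg = \<lparr>verts = cv ` R, arcs = ce ` A, tail = cv \<circ> tail (dg K) \<circ> g, head = cv \<circ> head (dg K) \<circ> g\<rparr>,
       bar = ce \<circ> bar K \<circ> g\<rparr>"
  have inv: "involutive_graph L"
    unfolding involutive_graph_def wf_digraph_def using A headR barA
    by (auto simp: L_def g barK subset_iff) (auto simp: A_def)
  interpret L: wf_digraph "dg L" using inv by (simp add: involutive_graph_def)
  have reach: "cv x0 \<rightarrow>\<^sup>*\<^bsub>dg L\<^esub> cv y" if "x0 \<rightarrow>\<^sup>*\<^bsub>dg K\<^esub> y" for y
    using that
  proof (induction rule: K.reachable_induct)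
    case base
    have "cv x0 \<in> verts (dg L)" by (simp add: L_def R_def x0)
    then show ?case by simp
  next
    case (step y z)
    then obtain e where e: "e \<in> arcs (dg K)" "tail (dg K) e = y" "head (dg K) e = z" by auto
    with step have eA: "e \<in> A" by (simp add: A_def R_def)
    then have "ce e \<in> arcs (dg L)" by (simp add: L_def)
    from L.in_arcs_imp_in_arcs_ends[OF this] have "cv y \<rightarrow>\<^bsub>dg L\<^esub> cv z"
      by (simp add: L_def g[OF eA] e)
    with step.IH show ?case by (rule L.reachable_adj_trans)
  qed
  \<comment> \<open>Paths from the base vertex suffice: reachability is symmetric in a graph closed
    under reversal, so \<open>u\<close> leads back to \<open>cv x0\<close> and from there to
    \<open>v\<close>.\<close>
  have "strongly_connected (dg L)"
  proof
    show "verts (dg L) \<noteq> {}" using x0 by (auto simp: L_def R_def)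
  next
    fix u v assume "u \<in> verts (dg L)" "v \<in> verts (dg L)"
    then have "cv x0 \<rightarrow>\<^sup>*\<^bsub>dg L\<^esub> u" "cv x0 \<rightarrow>\<^sup>*\<^bsub>dg L\<^esub> v"
      using reach by (auto simp: L_def R_def)
    then show "u \<rightarrow>\<^sup>*\<^bsub>dg L\<^esub> v"
      using symmetric_reachable[OF involutive_graph_symmetric[OF inv]] L.reachable_trans by blast
  qed
  then have "color_graph L"
    using inv by (simp add: color_graph_iff Digraph_Component.connected_def strongly_connected_def L.reachable_mk_symmetricI)
  moreover have "fin_digraph (dg L)"
    using finite_subset[OF R] finite_subset[OF A] by unfold_locales (auto simp: L_def)
  moreover have "graph_hom L K f g"
    using R A barA headR by (auto simp: graph_hom_def L_def f g A_def subset_iff)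
  moreover have "bij_betw g (star L y) (star K (f y))" if "y \<in> verts (dg L)" for y
  proof -
    from that obtain x where x: "x \<in> R" "y = cv x" by (auto simp: L_def)
    have tailR: "tail (dg K) e \<in> R" if "e \<in> A" for e using that by (simp add: A_def)
    have starK: "star K x = {e \<in> A. tail (dg K) e = x}" using x(1) by (auto simp: A_def)
    have "star L y = ce ` {e \<in> A. cv (tail (dg K) e) = cv x}"
      by (auto simp: L_def g x(2))
    also have "\<dots> = ce ` star K x"
      using cv_eq[OF tailR x(1)] unfolding starK by blast
    finally have starL: "star L y = ce ` star K x" .
    show ?thesis unfolding starL f[OF x(1), folded x(2)]
      by (rule bij_betw_byWitness[where f' = ce]) (use g in \<open>auto simp: starK\<close>)
  qed
  ultimately show thesis by (rule that)
qed

section \<open>Gluing local star maps into a graph over two graphs\<close>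

text \<open>Each \<open>x\<close> in \<open>X\<close> stands for a map \<open>\<phi> x\<close> from
  the star of \<open>p x\<close> to the star of \<open>p' x\<close>, and \<open>S e e'\<close>
  consists of those \<open>x\<close> from which an arc over \<open>(e, e')\<close> has to depart.
  Reversal must match these arcs with the arcs over the reversed pair, which is possible because the
  two sets have the same size. An arc \<open>e\<close> at \<open>p x\<close> has exactly one lift at
  \<open>x\<close>, lying over \<open>(e, \<phi> x e)\<close>, hence the bijection of stars.\<close>

lemma fibre_product_graph:
  fixes G\<^sub>1 :: "('v, 'e, 'y) igraph_scheme" and G\<^sub>2 :: "('w, 'f, 'z) igraph_scheme" and X :: "'x set"
    and p :: "'x \<Rightarrow> 'v" and p' :: "'x \<Rightarrow> 'w" and \<phi> :: "'x \<Rightarrow> 'e \<Rightarrow> 'f"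
  defines "S \<equiv> \<lambda>e e'. {x \<in> X. p x = tail (dg G\<^sub>1) e \<and> p' x = tail (dg G\<^sub>2) e' \<and> \<phi> x e = e'}"
  assumes G1: "involutive_graph G\<^sub>1" "fin_digraph (dg G\<^sub>1)"
    and G2: "involutive_graph G\<^sub>2" "fin_digraph (dg G\<^sub>2)"
    and X: "finite X" "p ` X \<subseteq> verts (dg G\<^sub>1)" "p' ` X \<subseteq> verts (dg G\<^sub>2)"
    and \<phi>: "\<And>x e. \<lbrakk>x \<in> X; e \<in> star G\<^sub>1 (p x)\<rbrakk> \<Longrightarrow> \<phi> x e \<in> star G\<^sub>2 (p' x)"
    and balanced: "\<And>e e'. \<lbrakk>e \<in> arcs (dg G\<^sub>1); e' \<in> arcs (dg G\<^sub>2)\<rbrakk>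
      \<Longrightarrow> card (S e e') = card (S (bar G\<^sub>1 e) (bar G\<^sub>2 e'))"
  obtains K :: "('x, 'e \<times> 'f \<times> nat) igraph"
    where "involutive_graph K" "fin_digraph (dg K)" "verts (dg K) = X"
      "graph_hom K G\<^sub>1 p fst" "graph_hom K G\<^sub>2 p' (fst \<circ> snd)"
      "\<And>x. x \<in> X \<Longrightarrow> bij_betw fst (star K x) (star G\<^sub>1 (p x))"
      "\<And>x a. \<lbrakk>x \<in> X; a \<in> star K x\<rbrakk> \<Longrightarrow> fst (snd a) = \<phi> x (fst a)"
proof -
  interpret G1: fin_digraph "dg G\<^sub>1" by fact
  interpret G2: fin_digraph "dg G\<^sub>2" by fact
  have bar1: "bar G\<^sub>1 e \<in> arcs (dg G\<^sub>1)" "bar G\<^sub>1 (bar G\<^sub>1 e) = e"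
      "tail (dg G\<^sub>1) (bar G\<^sub>1 e) = head (dg G\<^sub>1) e" if "e \<in> arcs (dg G\<^sub>1)" for e
    using G1(1) that by (auto simp: involutive_graph_def)
  have bar2: "bar G\<^sub>2 e \<in> arcs (dg G\<^sub>2)" "bar G\<^sub>2 (bar G\<^sub>2 e) = e"
      "tail (dg G\<^sub>2) (bar G\<^sub>2 e) = head (dg G\<^sub>2) e" if "e \<in> arcs (dg G\<^sub>2)" for e
    using G2(1) that by (auto simp: involutive_graph_def)
  have finS: "finite (S e e')" for e e'
    using X(1) by (simp add: S_def)
  obtain en where en: "\<And>e e'. bij_betw (en e e') {0..<card (S e e')} (S e e')"
    using ex_bij_betw_nat_finite[OF finS] by metis
  have enS: "en e e' t \<in> S e e'" if "t < card (S e e')" for e e' t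
    using bij_betwE[OF en] that by simp
  \<comment> \<open>The arc \<open>(e, e', t)\<close> departs from the element number
    \<open>t\<close> of \<open>S e e'\<close>, counted from 0.\<close>
  define A where "A = {(e, e', t) | e e' t. e \<in> arcs (dg G\<^sub>1) \<and> e' \<in> arcs (dg G\<^sub>2) \<and> t < card (S e e')}"
  define tl where "tl = (\<lambda>(e, e', t). en e e' t)"
  \<comment> \<open>Two vertices are joined when they have the same index \<open>t\<close> in the enumerations of
    \<open>S e e'\<close> and \<open>S (bar e) (bar e')\<close>; so reversal keeps \<open>t\<close> and no choice of matchings is needed.\<close>
  define br where "br = (\<lambda>(e, e', t :: nat). (bar G\<^sub>1 e, bar G\<^sub>2 e', t))"
  define K where "K = \<lparr>dg = \<lparr>verts = X, arcs = A, tail = tl, head = tl \<circ> br\<rparr>, bar = br\<rparr>"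
  have A_cases: "\<exists>e e' t. a = (e, e', t) \<and> e \<in> arcs (dg G\<^sub>1) \<and> e' \<in> arcs (dg G\<^sub>2) \<and>
      t < card (S e e')" if "a \<in> A" for a
    using that by (auto simp: A_def)
  have br: "br a \<in> A" "br (br a) = a" if "a \<in> A" for a
    using A_cases[OF that] by (auto simp: A_def br_def bar1 bar2 balanced[symmetric])
  have tl: "tl a \<in> X" "p (tl a) = tail (dg G\<^sub>1) (fst a)" "p' (tl a) = tail (dg G\<^sub>2) (fst (snd a))"
      "\<phi> (tl a) (fst a) = fst (snd a)" if "a \<in> A" for a
    using A_cases[OF that] enS unfolding tl_def S_def by fastforce+
  have br_fst: "fst (br a) = bar G\<^sub>1 (fst a)" "fst (snd (br a)) = bar G\<^sub>2 (fst (snd a))" for a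
    by (auto simp: br_def split: prod.splits)
  have A_fst: "fst a \<in> arcs (dg G\<^sub>1)" "fst (snd a) \<in> arcs (dg G\<^sub>2)" if "a \<in> A" for a
    using A_cases[OF that] by auto
  have inv: "involutive_graph K"
    unfolding involutive_graph_def wf_digraph_def by (auto simp: K_def br tl)
  have "finite A"
  proof (rule finite_subset)
    show "A \<subseteq> arcs (dg G\<^sub>1) \<times> arcs (dg G\<^sub>2) \<times> {..card X}"
    proof
      fix a assume "a \<in> A"
      then obtain e e' t where a: "a = (e, e', t)" "e \<in> arcs (dg G\<^sub>1)" "e' \<in> arcs (dg G\<^sub>2)"
        "t < card (S e e')" using A_cases by blast
      moreover have "card (S e e') \<le> card X" by (rule card_mono[OF X(1)]) (auto simp: S_def)
      ultimately show "a \<in> arcs (dg G\<^sub>1) \<times> arcs (dg G\<^sub>2) \<times> {..card X}" by auto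
    qed
  qed auto
  then have fin: "fin_digraph (dg K)"
    using X(1) inv by (auto simp: fin_digraph_def fin_digraph_axioms_def involutive_graph_def K_def)
  have hom1: "graph_hom K G\<^sub>1 p fst"
    using X by (simp add: graph_hom_def image_subset_iff K_def A_fst tl br br_fst bar1)
  have hom2: "graph_hom K G\<^sub>2 p' (fst \<circ> snd)"
    using X by (simp add: graph_hom_def image_subset_iff K_def A_fst tl br br_fst bar2)
  have bij: "bij_betw fst (star K x) (star G\<^sub>1 (p x))" if x: "x \<in> X" for x
    unfolding bij_betw_def
  proof
    \<comment> \<open>Once \<open>x\<close> and the first component \<open>e\<close> are given, the
      second component is forced to be \<open>\<phi> x e\<close>, and injectivity of the enumeration
      then forces \<open>t\<close>.\<close>
    show "inj_on fst (star K x)"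
    proof (rule inj_onI)
      fix a b assume ab: "a \<in> star K x" "b \<in> star K x" "fst a = fst b"
      then have A: "a \<in> A" "b \<in> A" and t: "tl a = x" "tl b = x" by (auto simp: K_def)
      obtain e e' t where a: "a = (e, e', t)" "t < card (S e e')" using A_cases[OF A(1)] by auto
      obtain e'' t' where b: "b = (e, e'', t')" "t' < card (S e e'')"
        using A_cases[OF A(2)] ab(3) a by auto
      have "e' = e''" using tl(4)[OF A(1)] tl(4)[OF A(2)] t a b by simp
      moreover have "t = t'"
        using t a b \<open>e' = e''\<close> bij_betw_imp_inj_on[OF en[of e e']]
        by (auto simp: tl_def dest: inj_onD)
      ultimately show "a = b" using a b by simp
    qed
    show "fst ` star K x = star G\<^sub>1 (p x)"
    proof
      show "fst ` star K x \<subseteq> star G\<^sub>1 (p x)"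
      proof (rule image_subsetI)
        fix a assume "a \<in> star K x"
        then have "a \<in> A" "tl a = x" by (simp_all add: K_def)
        then show "fst a \<in> star G\<^sub>1 (p x)" using A_fst(1)[of a] tl(2)[of a] by simp
      qed
      show "star G\<^sub>1 (p x) \<subseteq> fst ` star K x"
      proof
        fix e assume e: "e \<in> star G\<^sub>1 (p x)"
        have e': "\<phi> x e \<in> star G\<^sub>2 (p' x)" using \<phi> x e by blast
        then have "x \<in> S e (\<phi> x e)" using x e by (simp add: S_def)
        then have "x \<in> en e (\<phi> x e) ` {0..<card (S e (\<phi> x e))}"
          using bij_betw_imp_surj_on[OF en[of e "\<phi> x e"]] by simp
        then obtain t where "t < card (S e (\<phi> x e))" "en e (\<phi> x e) t = x" by auto
        then have "(e, \<phi> x e, t) \<in> star K x" using e e' by (simp add: K_def A_def tl_def)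
        then show "e \<in> fst ` star K x" by force
      qed
    qed
  qed
  have "fst (snd a) = \<phi> x (fst a)" if "a \<in> star K x" for x a
    using that tl(4)[of a] by (auto simp: K_def)
  then show thesis by (intro that[OF inv fin _ hom1 hom2 bij]) (auto simp: K_def)
qed

section \<open>Group actions: transport along bijections, and transporters\<close>

text \<open>The action is conjugated by \<open>q\<close>. Elements of \<open>Bij E'\<close> are
  extensional, which is why the transported maps are restricted to \<open>E'\<close>.\<close>

lemma (in group_action) group_action_transport:
  assumes q: "bij_betw q E' E"
  shows "group_action G E' (\<lambda>g. \<lambda>a\<in>E'. inv_into E' q (\<phi> g (q a)))"
proof -
  let ?\<psi> = "\<lambda>g. \<lambda>a\<in>E'. inv_into E' q (\<phi> g (q a))"
  have inE: "\<phi> g (q a) \<in> E" if "g \<in> carrier G" "a \<in> E'" for g a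
    using that bij_betwE[OF q] element_image[OF _ _ refl] by simp
  have inE': "inv_into E' q y \<in> E'" "q (inv_into E' q y) = y" if "y \<in> E" for y
    using that bij_betw_imp_surj_on[OF q] by (simp_all add: inv_into_into f_inv_into_f)
  have Bij: "?\<psi> g \<in> Bij E'" if g: "g \<in> carrier G" for g
  proof -
    have "bij_betw (\<phi> g) E E" using bij_prop0[OF g] by (simp add: Bij_def)
    then have "bij_betw (inv_into E' q \<circ> (\<phi> g \<circ> q)) E' E'"
      by (rule bij_betw_trans[OF bij_betw_trans[OF q] bij_betw_inv_into[OF q]])
    then show ?thesis by (simp add: Bij_def bij_betw_restrict_eq o_def)
  qed
  have "?\<psi> (g \<otimes> h) = compose E' (?\<psi> g) (?\<psi> h)" if gh: "g \<in> carrier G" "h \<in> carrier G" for g h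
  proof
    fix a
    show "?\<psi> (g \<otimes> h) a = compose E' (?\<psi> g) (?\<psi> h) a"
    proof (cases "a \<in> E'")
      case True
      then have "q a \<in> E" using bij_betwE[OF q] by blast
      then show ?thesis using True inE'[OF inE[OF gh(2) True]] composition_rule gh by (simp add: compose_def)
    qed (simp add: compose_def)
  qed
  then have "?\<psi> \<in> hom G (BijGroup E')"
    using Bij by (simp add: hom_def BijGroup_def Pi_def)
  moreover have "group G" using group_hom by (simp add: group_hom_def)
  ultimately show ?thesis
    by (simp add: group_action_def group_hom_def group_hom_axioms_def group_BijGroup)
qed

text \<open>If \<open>a\<close> sends \<open>x\<close> to \<open>y\<close> and \<open>b\<close>
  sends \<open>x\<close> to \<open>z\<close>, the elements taking \<open>y\<close> to
  \<open>z\<close> form the translate of the stabilizer of \<open>x\<close> by \<open>b\<close> on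
  the left and by the inverse of \<open>a\<close> on the right.\<close>

lemma (in group_action) card_transporter:
  assumes x: "x \<in> E"
    and yz: "y \<in> Group_Action.orbit G \<phi> x" "z \<in> Group_Action.orbit G \<phi> x"
  shows "card {g \<in> carrier G. \<phi> g y = z} = card (stabilizer G \<phi> x)"
proof -
  interpret group G using group_hom by (simp add: group_hom_def)
  obtain a b where a: "a \<in> carrier G" "\<phi> a x = y" and b: "b \<in> carrier G" "\<phi> b x = z"
    using yz by (auto simp: Group_Action.orbit_def)
  have y: "y \<in> E" using element_image[OF a(1) x a(2)] .
  have inva: "\<phi> (inv a) y = x" using orbit_sym_aux[OF a(1) x a(2)] .
  have invb: "\<phi> (inv b) z = x" using orbit_sym_aux[OF b(1) x b(2)] .
  have cancel: "inv b \<otimes> (b \<otimes> g) = g" "b \<otimes> (inv b \<otimes> g) = g" if "g \<in> carrier G" for g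
    using that b by (simp_all flip: m_assoc)
  have "bij_betw (\<lambda>g. b \<otimes> g \<otimes> inv a) (stabilizer G \<phi> x) {g \<in> carrier G. \<phi> g y = z}"
  proof (rule bij_betw_byWitness[where f' = "\<lambda>g. inv b \<otimes> g \<otimes> a"])
    show "(\<lambda>g. b \<otimes> g \<otimes> inv a) ` stabilizer G \<phi> x \<subseteq> {g \<in> carrier G. \<phi> g y = z}"
      using a b x y inva by (auto simp: stabilizer_def composition_rule)
    show "(\<lambda>g. inv b \<otimes> g \<otimes> a) ` {g \<in> carrier G. \<phi> g y = z} \<subseteq> stabilizer G \<phi> x"
      using a b x y invb by (auto simp: stabilizer_def composition_rule)
  qed (use a b cancel in \<open>auto simp: stabilizer_def m_assoc\<close>)
  then show ?thesis using bij_betw_same_card by fastforce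
qed

section \<open>Symmetry-restricted data and charts of stars\<close>

lemma sr_data_group_action:
  assumes "is_sr_data C D" "i \<in> verts (dg C)"
  shows "group_action (grp D i) (pts D i) (gact D i)"
  using assms by (simp add: is_sr_data_def faithful_action_def)

text \<open>By transitivity any point of an orbit can serve as its base point, in particular the one
  whose stabilizer was selected by \<open>stabilizer_choice\<close>.\<close>

lemma sr_data_orb:
  assumes D: "is_sr_data C D" and i: "i \<in> verts (dg C)" and k: "k \<in> star C i" and x: "x \<in> orb D k"
  shows "x \<in> pts D i" "orb D k = Group_Action.orbit (grp D i) (gact D i) x"
proof -
  interpret act: group_action "grp D i" "pts D i" "gact D i"
    by (rule sr_data_group_action[OF D i])
  have "orb D k \<in> orbits (grp D i) (pts D i) (gact D i)"
    using D i k bij_betwE unfolding is_sr_data_def by blast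
  then obtain x0 where x0: "x0 \<in> pts D i" "orb D k = Group_Action.orbit (grp D i) (gact D i) x0"
    by (auto simp: orbits_def)
  have sub: "orb D k \<subseteq> pts D i" using x0 by (auto simp: Group_Action.orbit_def act.element_image[OF _ _ refl])
  then show xE: "x \<in> pts D i" using x by blast
  have x_orb: "x \<in> Group_Action.orbit (grp D i) (gact D i) x0" using x x0(2) by simp
  show "orb D k = Group_Action.orbit (grp D i) (gact D i) x"
  proof (intro equalityI subsetI)
    fix y assume y: "y \<in> orb D k"
    with sub have "y \<in> pts D i" by blast
    from act.orbit_trans[OF xE x0(1) this act.orbit_sym[OF x0(1) xE x_orb]] y x0(2)
    show "y \<in> Group_Action.orbit (grp D i) (gact D i) x" by simp
  next
    fix y assume y: "y \<in> Group_Action.orbit (grp D i) (gact D i) x"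
    then have "y \<in> pts D i" using xE by (auto simp: Group_Action.orbit_def act.element_image[OF _ _ refl])
    from act.orbit_trans[OF x0(1) xE this x_orb y] x0(2) show "y \<in> orb D k" by simp
  qed
qed

lemma sr_graph_vcol: "vcol G v \<in> verts (dg C)" if "is_sr_graph C D G" "v \<in> verts (dg G)"
  using that by (auto simp: is_sr_graph_def graph_hom_def)

lemma sr_graph_ecol: "ecol G e \<in> star C (vcol G v)" if "is_sr_graph C D G" "e \<in> star G v"
  using that by (auto simp: is_sr_graph_def graph_hom_def)

lemma sr_graph_group_action:
  "group_action (grp D (vcol G v)) (star G v) (sact G v)" if "is_sr_graph C D G" "v \<in> verts (dg G)"
  using that by (simp add: is_sr_graph_def)

text \<open>These are the conditions on the witness \<open>h\<close> in \<open>is_sr_graph\<close>: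
  a chart identifies a star with the model permutation representation of its color.\<close>

definition is_star_chart ::
  "('i, 'k, 'z) igraph_scheme \<Rightarrow> ('i, 'k, 'd, 'x) sr_data \<Rightarrow> ('v, 'e, 'i, 'k, 'd) sr_graph
     \<Rightarrow> 'v \<Rightarrow> ('x \<Rightarrow> 'e) \<Rightarrow> bool" where
  "is_star_chart C D G v h \<longleftrightarrow>
     bij_betw h (pts D (vcol G v)) (star G v) \<and>
     (\<forall>\<delta> \<in> carrier (grp D (vcol G v)). \<forall>y \<in> pts D (vcol G v).
        h (gact D (vcol G v) \<delta> y) = sact G v \<delta> (h y)) \<and>
     (\<forall>k \<in> star C (vcol G v). h ` orb D k = {e \<in> star G v. ecol G e = k})"

lemma is_star_chartD:
  assumes "is_star_chart C D G v h"
  shows "bij_betw h (pts D (vcol G v)) (star G v)"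
    and "\<And>\<delta> y. \<lbrakk>\<delta> \<in> carrier (grp D (vcol G v)); y \<in> pts D (vcol G v)\<rbrakk>
       \<Longrightarrow> h (gact D (vcol G v) \<delta> y) = sact G v \<delta> (h y)"
    and "\<And>k. k \<in> star C (vcol G v) \<Longrightarrow> h ` orb D k = {e \<in> star G v. ecol G e = k}"
  using assms by (simp_all add: is_star_chart_def del: in_out_arcs_conv)

lemma is_sr_graph_iff_star_chart:
  "is_sr_graph C D G \<longleftrightarrow>
     ordinary_graph G \<and> graph_hom G C (vcol G) (ecol G) \<and>
     (\<forall>v \<in> verts (dg G). group_action (grp D (vcol G v)) (star G v) (sact G v) \<and>
        (\<exists>h. is_star_chart C D G v h))"
  by (simp only: is_sr_graph_def is_star_chart_def)

lemma sr_graph_star_chart: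
  assumes "is_sr_graph C D G" "v \<in> verts (dg G)"
  obtains h where "is_star_chart C D G v h"
  using assms by (auto simp only: is_sr_graph_iff_star_chart)

text \<open>A chart carries the orbit indexed by \<open>k\<close> onto the \<open>k\<close>-edges of
  the star, and orbits are invariant under the group.\<close>

lemma ecol_sact:
  assumes D: "is_sr_data C D" and G: "is_sr_graph C D G" and v: "v \<in> verts (dg G)"
    and \<delta>: "\<delta> \<in> carrier (grp D (vcol G v))" and e: "e \<in> star G v"
  shows "ecol G (sact G v \<delta> e) = ecol G e"
proof -
  let ?k = "ecol G e"
  obtain h where "is_star_chart C D G v h" by (rule sr_graph_star_chart[OF G v])
  note h = is_star_chartD[OF this]
  note k = sr_graph_ecol[OF G e]
  have "e \<in> h ` orb D ?k" using h(3)[OF k] e by simp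
  then obtain y where y: "y \<in> orb D ?k" "e = h y" by blast
  note orb = sr_data_orb[OF D sr_graph_vcol[OF G v] k y(1)]
  have "gact D (vcol G v) \<delta> y \<in> orb D ?k" using \<delta> orb(2) by (auto simp: Group_Action.orbit_def)
  then have "h (gact D (vcol G v) \<delta> y) \<in> {e \<in> star G v. ecol G e = ?k}" using h(3)[OF k] by blast
  then show ?thesis using h(2)[OF \<delta> orb(1)] y(2) by simp
qed

section \<open>Pulling the structure back along a map bijective on stars\<close>

text \<open>The action on each star is the one for which \<open>q\<close> is strictly equivariant,
  without any conjugation.\<close>

definition sr_pullback ::
  "('w, 'f) igraph \<Rightarrow> ('w \<Rightarrow> 'v) \<Rightarrow> ('f \<Rightarrow> 'e) \<Rightarrow> ('v, 'e, 'i, 'k, 'd) sr_graph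
     \<Rightarrow> ('w, 'f, 'i, 'k, 'd) sr_graph" where
  "sr_pullback L p q G =
     \<lparr>dg = dg L, bar = bar L, vcol = vcol G \<circ> p, ecol = ecol G \<circ> q,
      sact = (\<lambda>x \<delta>. \<lambda>a \<in> star L x. inv_into (star L x) q (sact G (p x) \<delta> (q a)))\<rparr>"

text \<open>Charts of \<open>G\<close> composed with the inverse of \<open>q\<close> on a star are
  charts upstairs. An edge equal to its own reverse would be mapped by \<open>q\<close> to such an
  edge of \<open>G\<close>, so the pullback is an ordinary graph.\<close>

lemma is_sr_graph_pullback:
  assumes G: "is_sr_graph C D G" and L: "color_graph L" and hom: "graph_hom L G p q"
    and bij: "\<And>x. x \<in> verts (dg L) \<Longrightarrow> bij_betw q (star L x) (star G (p x))"
  shows "is_sr_graph C D (sr_pullback L p q G)"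
proof -
  let ?P = "sr_pullback L p q G"
  have dgP: "dg ?P = dg L" "bar ?P = bar L" by (simp_all add: sr_pullback_def)
  have "ordinary_graph ?P"
    unfolding ordinary_graph_def
  proof
    show "color_graph ?P" using L by (simp add: color_graph_def dgP)
    have "q (bar L a) \<noteq> q a" if "a \<in> arcs (dg L)" for a
    proof -
      have "q a \<in> arcs (dg G)" "q (bar L a) = bar G (q a)"
        using that hom by (auto simp: graph_hom_def)
      then show ?thesis using G by (simp add: is_sr_graph_def ordinary_graph_def)
    qed
    then show "\<forall>a \<in> arcs (dg ?P). bar ?P a \<noteq> a" unfolding dgP by metis
  qed
  moreover have "graph_hom ?P C (vcol ?P) (ecol ?P)"
  proof -
    have "graph_hom L C (vcol G \<circ> p) (ecol G \<circ> q)"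
      using G by (intro graph_hom_comp[OF hom]) (simp add: is_sr_graph_def)
    then show ?thesis by (simp add: graph_hom_def sr_pullback_def)
  qed
  moreover have "group_action (grp D (vcol ?P x)) (star ?P x) (sact ?P x) \<and>
      (\<exists>h. is_star_chart C D ?P x h)"
    if x: "x \<in> verts (dg ?P)" for x
  proof -
    have px: "p x \<in> verts (dg G)" using x hom by (auto simp: dgP graph_hom_def)
    let ?i = "vcol G (p x)"
    note act = sr_graph_group_action[OF G px]
    obtain h where "is_star_chart C D G (p x) h" by (rule sr_graph_star_chart[OF G px])
    note h = is_star_chartD[OF this]
    note q = bij[OF x[unfolded dgP]]
    have P_sel: "vcol ?P x = ?i" "star ?P x = star L x" "ecol ?P a = ecol G (q a)" for a
      by (simp_all add: sr_pullback_def)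
    define r where "r = inv_into (star L x) q"
    have r: "r e \<in> star L x" "q (r e) = e" if "e \<in> star G (p x)" for e
      using that bij_betw_imp_surj_on[OF q] unfolding r_def
      by (metis inv_into_into, metis f_inv_into_f)
    have rq: "r (q a) = a" if "a \<in> star L x" for a
      using that bij_betw_imp_inj_on[OF q] by (simp add: r_def)
    have hE: "h y \<in> star G (p x)" if "y \<in> pts D ?i" for y
      using that bij_betwE[OF h(1)] by blast
    have "bij_betw (r \<circ> h) (pts D ?i) (star L x)"
      using bij_betw_trans[OF h(1)] bij_betw_inv_into[OF q] by (simp add: r_def)
    moreover have "(r \<circ> h) (gact D ?i \<delta> y) = sact ?P x \<delta> ((r \<circ> h) y)"
      if "\<delta> \<in> carrier (grp D ?i)" "y \<in> pts D ?i" for \<delta> y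
    proof -
      have "(r \<circ> h) (gact D ?i \<delta> y) = r (sact G (p x) \<delta> (h y))" using h(2) that by simp
      also have "\<dots> = sact ?P x \<delta> (r (h y))"
        using r[OF hE[OF that(2)]] by (simp add: sr_pullback_def r_def del: in_out_arcs_conv)
      finally show ?thesis by simp
    qed
    moreover have "(r \<circ> h) ` orb D k = {a \<in> star L x. ecol G (q a) = k}" if "k \<in> star C ?i" for k
    proof -
      have "(r \<circ> h) ` orb D k = r ` {e \<in> star G (p x). ecol G e = k}"
        by (simp only: image_comp[symmetric] h(3)[OF that])
      also have "\<dots> = {a \<in> star L x. ecol G (q a) = k}"
      proof (intro equalityI subsetI)
        fix a assume a: "a \<in> {a \<in> star L x. ecol G (q a) = k}"
        then have "q a \<in> {e \<in> star G (p x). ecol G e = k}" "a = r (q a)"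
          using bij_betwE[OF q] rq by auto
        then show "a \<in> r ` {e \<in> star G (p x). ecol G e = k}" by (rule rev_image_eqI)
      qed (use r in auto)
      finally show ?thesis .
    qed
    ultimately have "is_star_chart C D ?P x (r \<circ> h)"
      unfolding is_star_chart_def P_sel by blast
    moreover have "group_action (grp D ?i) (star L x) (sact ?P x)"
      using group_action.group_action_transport[OF act q] by (simp add: sr_pullback_def)
    ultimately show ?thesis unfolding P_sel by blast
  qed
  ultimately show ?thesis unfolding is_sr_graph_iff_star_chart by blast
qed

text \<open>On each star \<open>q'\<close> is \<open>\<phi> x\<close> after \<open>q\<close>, and
  \<open>q\<close> is strictly equivariant, so a conjugating element for \<open>\<phi> x\<close>
  also works for \<open>q'\<close>. The lemma yields both covering maps: with the identity as
  \<open>\<phi> x\<close> for one graph, with the glued star maps for the other.\<close>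

lemma sr_morphism_pullback:
  assumes G: "is_sr_graph C D G" and hom: "graph_hom L G p q"
    and bij: "\<And>x. x \<in> verts (dg L) \<Longrightarrow> bij_betw q (star L x) (star G (p x))"
    and hom': "graph_hom L G' p' q'"
    and vcol: "\<And>x. x \<in> verts (dg L) \<Longrightarrow> vcol G' (p' x) = vcol G (p x)"
    and ecol: "\<And>a. a \<in> arcs (dg L) \<Longrightarrow> ecol G' (q' a) = ecol G (q a)"
    and \<phi>_bij: "\<And>x. x \<in> verts (dg L) \<Longrightarrow> bij_betw (\<phi> x) (star G (p x)) (star G' (p' x))"
    and \<phi>_equi: "\<And>x. x \<in> verts (dg L) \<Longrightarrow>
      weakly_equivariant (grp D (vcol G (p x))) (star G (p x)) (sact G (p x)) (sact G' (p' x)) (\<phi> x)"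
    and \<phi>: "\<And>x a. \<lbrakk>x \<in> verts (dg L); a \<in> star L x\<rbrakk> \<Longrightarrow> q' a = \<phi> x (q a)"
  shows "sr_morphism D (sr_pullback L p q G) G' p' q'"
proof -
  let ?P = "sr_pullback L p q G"
  have "bij_betw q' (star L x) (star G' (p' x)) \<and>
      weakly_equivariant (grp D (vcol G (p x))) (star L x) (sact ?P x) (sact G' (p' x)) q'"
    if x: "x \<in> verts (dg L)" for x
  proof
    note q = bij[OF x]
    have "bij_betw (\<phi> x \<circ> q) (star L x) (star G' (p' x))"
      using bij_betw_trans[OF q \<phi>_bij[OF x]] .
    moreover have "bij_betw (\<phi> x \<circ> q) (star L x) (star G' (p' x)) \<longleftrightarrow> bij_betw q' (star L x) (star G' (p' x))"
      by (rule bij_betw_cong) (simp add: \<phi>[OF x])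
    ultimately show "bij_betw q' (star L x) (star G' (p' x))" by blast
    have px: "p x \<in> verts (dg G)" using x hom by (auto simp: graph_hom_def)
    interpret act: group_action "grp D (vcol G (p x))" "star G (p x)" "sact G (p x)"
      by (rule sr_graph_group_action[OF G px])
    obtain \<gamma> where \<gamma>: "\<gamma> \<in> carrier (grp D (vcol G (p x)))"
      "\<And>e \<delta>. \<lbrakk>e \<in> star G (p x); \<delta> \<in> carrier (grp D (vcol G (p x)))\<rbrakk> \<Longrightarrow>
         \<phi> x (sact G (p x) \<delta> e) =
         sact G' (p' x) (\<gamma> \<otimes>\<^bsub>grp D (vcol G (p x))\<^esub> \<delta> \<otimes>\<^bsub>grp D (vcol G (p x))\<^esub>
           inv\<^bsub>grp D (vcol G (p x))\<^esub> \<gamma>) (\<phi> x e)"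
      using \<phi>_equi[OF x] unfolding weakly_equivariant_def by blast
    have "q' (sact ?P x \<delta> a) = \<phi> x (sact G (p x) \<delta> (q a))"
      if a: "a \<in> star L x" and \<delta>: "\<delta> \<in> carrier (grp D (vcol G (p x)))" for a \<delta>
    proof -
      have "sact G (p x) \<delta> (q a) \<in> star G (p x)"
        using act.element_image[OF \<delta> _ refl] bij_betwE[OF q] a by blast
      then have "sact G (p x) \<delta> (q a) \<in> q ` star L x" using bij_betw_imp_surj_on[OF q] by simp
      then have "sact ?P x \<delta> a \<in> star L x" "q (sact ?P x \<delta> a) = sact G (p x) \<delta> (q a)"
        using a by (simp_all add: sr_pullback_def inv_into_into f_inv_into_f del: in_out_arcs_conv)
      then show ?thesis using \<phi>[OF x] by simp
    qed
    then show "weakly_equivariant (grp D (vcol G (p x))) (star L x) (sact ?P x) (sact G' (p' x)) q'"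
      unfolding weakly_equivariant_def using \<gamma> bij_betwE[OF q]
      by (intro bexI[of _ \<gamma>]) (simp_all add: \<phi>[OF x] del: in_out_arcs_conv)
  qed
  then show ?thesis using hom' vcol ecol
    by (simp add: sr_morphism_def graph_hom_def sr_pullback_def)
qed

section \<open>Comparing stars and counting star maps\<close>

text \<open>Both stars are charted by the same model set, so the inverse of one chart followed by
  the other is strictly equivariant and preserves colors.\<close>

lemma sr_graph_star_iso:
  assumes D: "is_sr_data C D"
    and G: "is_sr_graph C D G" and G': "is_sr_graph C D G'"
    and v: "v \<in> verts (dg G)" "v' \<in> verts (dg G')" "vcol G v = vcol G' v'"
  shows "\<exists>f. bij_betw f (star G v) (star G' v') \<and>
    (\<forall>\<delta> \<in> carrier (grp D (vcol G v)). \<forall>e \<in> star G v. f (sact G v \<delta> e) = sact G' v' \<delta> (f e)) \<and>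
    (\<forall>e \<in> star G v. ecol G' (f e) = ecol G e)"
proof -
  let ?i = "vcol G v"
  obtain h where "is_star_chart C D G v h" by (rule sr_graph_star_chart[OF G v(1)])
  note h = is_star_chartD[OF this]
  obtain h' where "is_star_chart C D G' v' h'" by (rule sr_graph_star_chart[OF G' v(2)])
  note h' = is_star_chartD[OF this, folded v(3)]
  have i: "?i \<in> verts (dg C)" by (rule sr_graph_vcol[OF G v(1)])
  interpret act: group_action "grp D ?i" "pts D ?i" "gact D ?i"
    by (rule sr_data_group_action[OF D i])
  have orb_sub: "orb D k \<subseteq> pts D ?i" if "k \<in> star C ?i" for k
    using sr_data_orb(1)[OF D i that] by blast
  define g where "g = inv_into (pts D ?i) h"
  have g: "g e \<in> pts D ?i" "h (g e) = e" if "e \<in> star G v" for e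
    using that bij_betw_imp_surj_on[OF h(1)] unfolding g_def
    by (metis inv_into_into, metis f_inv_into_f)
  have gh: "g (h y) = y" if "y \<in> pts D ?i" for y
    using that bij_betw_imp_inj_on[OF h(1)] by (simp add: g_def)
  show ?thesis
  proof (intro exI[of _ "h' \<circ> g"] conjI ballI)
    show "bij_betw (h' \<circ> g) (star G v) (star G' v')"
      using bij_betw_trans[OF bij_betw_inv_into[OF h(1)] h'(1)] by (simp add: g_def)
  next
    fix \<delta> e assume \<delta>: "\<delta> \<in> carrier (grp D ?i)" and e: "e \<in> star G v"
    have "sact G v \<delta> e = h (gact D ?i \<delta> (g e))" using h(2)[OF \<delta>] g[OF e] by simp
    moreover have "gact D ?i \<delta> (g e) \<in> pts D ?i" using act.element_image[OF \<delta> g(1)[OF e] refl] .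
    ultimately show "(h' \<circ> g) (sact G v \<delta> e) = sact G' v' \<delta> ((h' \<circ> g) e)"
      using h'(2)[OF \<delta>] g[OF e] by (simp add: gh)
  next
    fix e assume e: "e \<in> star G v"
    let ?k = "ecol G e"
    note k = sr_graph_ecol[OF G e]
    have "e \<in> h ` orb D ?k" using h(3)[OF k] e by simp
    then have "g e \<in> orb D ?k" using gh orb_sub[OF k] by auto
    then have "h' (g e) \<in> {e \<in> star G' v'. ecol G' e = ?k}" using h'(3)[OF k] by blast
    then show "ecol G' ((h' \<circ> g) e) = ?k" by simp
  qed
qed

text \<open>A chart moves the question to the orbit indexed by the color, where
  \<open>card_transporter\<close> applies with the base point behind \<open>stabs\<close>.\<close>

lemma card_star_transporter:
  assumes D: "is_sr_data C D" and stabs: "stabilizer_choice C D stabs"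
    and G: "is_sr_graph C D G" and v: "v \<in> verts (dg G)"
    and e: "e \<in> star G v" "e' \<in> star G v" "ecol G e = ecol G e'"
  shows "card {\<delta> \<in> carrier (grp D (vcol G v)). sact G v \<delta> e = e'} = card (stabs (ecol G e))"
proof -
  let ?i = "vcol G v" and ?k = "ecol G e"
  obtain h where "is_star_chart C D G v h" by (rule sr_graph_star_chart[OF G v])
  note h = is_star_chartD[OF this]
  have i: "?i \<in> verts (dg C)" by (rule sr_graph_vcol[OF G v])
  note k = sr_graph_ecol[OF G e(1)]
  interpret act: group_action "grp D ?i" "pts D ?i" "gact D ?i"
    by (rule sr_data_group_action[OF D i])
  obtain x where x: "x \<in> orb D ?k" "stabs ?k = stabilizer (grp D ?i) (gact D ?i) x"
    using stabs k by (auto simp: stabilizer_choice_def)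
  note orb = sr_data_orb[OF D i k x(1)]
  have orb_sub: "orb D ?k \<subseteq> pts D ?i" using sr_data_orb(1)[OF D i k] by blast
  have "e \<in> h ` orb D ?k" "e' \<in> h ` orb D ?k" using h(3)[OF k] e by simp_all
  then obtain y z where y: "y \<in> orb D ?k" "e = h y" and z: "z \<in> orb D ?k" "e' = h z" by blast
  have "sact G v \<delta> e = e' \<longleftrightarrow> gact D ?i \<delta> y = z" if \<delta>: "\<delta> \<in> carrier (grp D ?i)" for \<delta>
  proof -
    have yz: "y \<in> pts D ?i" "z \<in> pts D ?i" using y z orb_sub by auto
    then have "gact D ?i \<delta> y \<in> pts D ?i" using act.element_image[OF \<delta> _ refl] by blast
    then have "h (gact D ?i \<delta> y) = h z \<longleftrightarrow> gact D ?i \<delta> y = z"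
      using inj_on_eq_iff[OF bij_betw_imp_inj_on[OF h(1)]] yz by blast
    then show ?thesis using h(2)[OF \<delta> yz(1)] y z by simp
  qed
  then have "{\<delta> \<in> carrier (grp D ?i). sact G v \<delta> e = e'} = {\<delta> \<in> carrier (grp D ?i). gact D ?i \<delta> y = z}"
    by blast
  then show ?thesis
    using act.card_transporter[OF orb(1), of y z] y z orb(2) x by auto
qed

text \<open>Of the isomorphism only the equality of orders is kept. The factors are indexed by
  positions in \<open>p\<close>, so repeated edges count with multiplicity.\<close>

lemma prod_list_card_eq_if_product_group_iso:
  fixes A B :: "'k \<Rightarrow> 'd monoid"
  assumes "product_group {..<length p} (\<lambda>j. A (p ! j)) \<cong> product_group {..<length p} (\<lambda>j. B (p ! j))"
  shows "(\<Prod>k\<leftarrow>p. card (carrier (A k))) = (\<Prod>k\<leftarrow>p. card (carrier (B k)))"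
proof -
  have "card (\<Pi>\<^sub>E j\<in>{..<length p}. carrier (A (p ! j))) = card (\<Pi>\<^sub>E j\<in>{..<length p}. carrier (B (p ! j)))"
    using assms by (auto simp: is_iso_def iso_def dest: bij_betw_same_card)
  moreover have "card (\<Pi>\<^sub>E j\<in>{..<length p}. carrier (M (p ! j))) = (\<Prod>k\<leftarrow>p. card (carrier (M k)))"
    for M :: "'k \<Rightarrow> 'd monoid"
    using prod.list_conv_set_nth[of "map (\<lambda>k. card (carrier (M k))) p"]
    by (simp add: card_PiE atLeast0LessThan)
  ultimately show ?thesis by simp
qed

section \<open>The fibre product of the two graphs and its component as common finite
  covering\<close>

theorem theorem4p1:
  fixes C :: "('i, 'k) igraph"
    and D :: "('i, 'k, 'd, 'x) sr_data"
    and stabs :: "'k \<Rightarrow> 'd set"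
    and G1 :: "('v1, 'e1, 'i, 'k, 'd) sr_graph"
    and G2 :: "('v2, 'e2, 'i, 'k, 'd) sr_graph"
    and H :: "('w, 'f, 'i, 'k, 'd) sr_graph"
  assumes "color_graph C"
    and "is_sr_data C D"
    and "stabilizer_choice C D stabs"
    and "\<And>p. wf_digraph.closed_w (dg C) p \<Longrightarrow>
           product_group {..<length p} (\<lambda>j. stab_group C D stabs (p ! j)) \<cong>
           product_group {..<length p} (\<lambda>j. stab_group C D stabs (bar C (p ! j)))"
    and "is_sr_graph C D G1" and "fin_digraph (dg G1)"
    and "is_sr_graph C D G2" and "fin_digraph (dg G2)"
    and "is_sr_graph C D H" and "sr_covers D H G1" and "sr_covers D H G2"
  shows "\<exists>K :: (nat, nat, 'i, 'k, 'd) sr_graph.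
           is_sr_graph C D K \<and> fin_digraph (dg K) \<and> sr_covers D K G1 \<and> sr_covers D K G2"
proof -
  note C = assms(1) and D = assms(2) and stabs = assms(3) and iso = assms(4)
  note G1 = assms(5) and G2 = assms(7)
  interpret F1: fin_digraph "dg G1" by fact
  interpret F2: fin_digraph "dg G2" by fact
  have inv: "involutive_graph C" "involutive_graph G1" "involutive_graph G2"
    using C G1 G2 by (simp_all add: is_sr_graph_def ordinary_graph_def color_graph_iff)
  have hom1: "graph_hom G1 C (vcol G1) (ecol G1)" and hom2: "graph_hom G2 C (vcol G2) (ecol G2)"
    using G1 G2 by (simp_all add: is_sr_graph_def)
  let ?\<Delta> = "\<lambda>v. grp D (vcol G1 v)"
  have grp: "group (?\<Delta> v)" "finite (carrier (?\<Delta> v))" if "v \<in> verts (dg G1)" for v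
    using D hom1 that
    by (auto simp: is_sr_data_def faithful_action_def group_action_def group_hom_def
        graph_hom_def image_subset_iff)

  define w where "w k = card (stabs k)" for k
  have w_pos: "0 < w k" if k: "k \<in> arcs (dg C)" for k
  proof -
    let ?i = "tail (dg C) k"
    have i: "?i \<in> verts (dg C)" using inv(1) k by (simp add: involutive_graph_def wf_digraph_def)
    interpret act: group_action "grp D ?i" "pts D ?i" "gact D ?i"
      by (rule sr_data_group_action[OF D i])
    obtain x where x: "x \<in> orb D k" "stabs k = stabilizer (grp D ?i) (gact D ?i) x"
      using stabs k by (auto simp: stabilizer_choice_def)
    have "x \<in> pts D ?i" using sr_data_orb(1)[OF D i _ x(1)] k by simp
    then have "stabs k \<noteq> {}" using act.stabilizer_one_closed x(2) by auto
    moreover have "finite (stabs k)"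
      using finite_subset[OF act.stabilizer_subset] D i x(2) by (auto simp: is_sr_data_def)
    ultimately show ?thesis by (simp add: w_def card_gt_0_iff)
  qed
  have w_closed: "(\<Prod>k\<leftarrow>p. w k) = (\<Prod>k\<leftarrow>p. w (bar C k))" if "wf_digraph.closed_w (dg C) p" for p
    using prod_list_card_eq_if_product_group_iso[where A = "stab_group C D stabs" and B = "\<lambda>k. stab_group C D stabs (bar C k)", OF iso[OF that]]
    by (simp add: stab_group_def w_def)
  \<comment> \<open>The colors that occur in \<open>G1\<close> form a finite set, whatever the size
    of \<open>C\<close>. They suffice because a vertex of the fibre product has the color of a
    vertex of \<open>G1\<close>.\<close>
  obtain m where m_pos: "\<And>v. v \<in> verts (dg G1) \<Longrightarrow> 0 < m (vcol G1 v)"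
    and m_raw: "\<And>k. \<lbrakk>k \<in> arcs (dg C); tail (dg C) k \<in> vcol G1 ` verts (dg G1);
        head (dg C) k \<in> vcol G1 ` verts (dg G1)\<rbrakk>
        \<Longrightarrow> m (tail (dg C) k) * w k = m (head (dg C) k) * w (bar C k)"
  proof (rule balanced_multiplicities[OF C _ _ w_pos w_closed])
    show "finite (vcol G1 ` verts (dg G1))" by simp
    show "vcol G1 ` verts (dg G1) \<subseteq> verts (dg C)" using hom1 by (simp add: graph_hom_def)
  qed auto
  have bar1: "bar G1 e \<in> arcs (dg G1)" "bar G1 (bar G1 e) = e"
      "tail (dg G1) (bar G1 e) = head (dg G1) e" "ecol G1 (bar G1 e) = bar C (ecol G1 e)"
      "ecol G1 e \<in> arcs (dg C)" "vcol G1 (tail (dg G1) e) = tail (dg C) (ecol G1 e)"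
      "vcol G1 (head (dg G1) e) = head (dg C) (ecol G1 e)"
    if "e \<in> arcs (dg G1)" for e
    using inv(2) hom1 that by (auto simp: involutive_graph_def graph_hom_def)
  have bar2: "bar G2 e \<in> arcs (dg G2)" "bar G2 (bar G2 e) = e"
      "ecol G2 (bar G2 e) = bar C (ecol G2 e)"
      "ecol G2 e \<in> arcs (dg C)" "vcol G2 (tail (dg G2) e) = tail (dg C) (ecol G2 e)"
    if "e \<in> arcs (dg G2)" for e
    using inv(3) hom2 that by (auto simp: involutive_graph_def graph_hom_def)
  have m: "m (vcol G1 (tail (dg G1) e)) * w (ecol G1 e) =
      m (vcol G1 (tail (dg G1) (bar G1 e))) * w (ecol G1 (bar G1 e))" if e: "e \<in> arcs (dg G1)" for e
  proof -
    have "vcol G1 (tail (dg G1) e) \<in> vcol G1 ` verts (dg G1)"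
      "vcol G1 (head (dg G1) e) \<in> vcol G1 ` verts (dg G1)" using e by simp_all
    then show ?thesis using m_raw[of "ecol G1 e"] by (simp add: bar1[OF e])
  qed

  have "\<exists>f. bij_betw f (star G1 v) (star G2 v') \<and>
      (\<forall>\<delta> \<in> carrier (?\<Delta> v). \<forall>e \<in> star G1 v. f (sact G1 v \<delta> e) = sact G2 v' \<delta> (f e)) \<and>
      (\<forall>e \<in> star G1 v. ecol G2 (f e) = ecol G1 e)"
    if "v \<in> verts (dg G1)" "v' \<in> verts (dg G2)" "vcol G1 v = vcol G2 v'" for v v'
    by (rule sr_graph_star_iso[OF D G1 G2 that])
  then obtain F where F: "\<And>v v'. \<lbrakk>v \<in> verts (dg G1); v' \<in> verts (dg G2); vcol G1 v = vcol G2 v'\<rbrakk> \<Longrightarrow>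
      bij_betw (F v v') (star G1 v) (star G2 v') \<and>
      (\<forall>\<delta> \<in> carrier (?\<Delta> v). \<forall>e \<in> star G1 v. F v v' (sact G1 v \<delta> e) = sact G2 v' \<delta> (F v v' e)) \<and>
      (\<forall>e \<in> star G1 v. ecol G2 (F v v' e) = ecol G1 e)"
    by metis
  have F_bij: "bij_betw (F v v') (star G1 v) (star G2 v')"
    and F_equi: "\<lbrakk>\<delta> \<in> carrier (?\<Delta> v); e \<in> star G1 v\<rbrakk>
      \<Longrightarrow> F v v' (sact G1 v \<delta> e) = sact G2 v' \<delta> (F v v' e)"
    and F_col: "e \<in> star G1 v \<Longrightarrow> ecol G2 (F v v' e) = ecol G1 e"
    if "v \<in> verts (dg G1)" "v' \<in> verts (dg G2)" "vcol G1 v = vcol G2 v'" for v v' \<delta> e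
    using F[OF that] by (simp_all del: in_out_arcs_conv)

  define X where "X = {(v, v', \<delta>, n :: nat) | v v' \<delta> n. v \<in> verts (dg G1) \<and> v' \<in> verts (dg G2) \<and>
    vcol G1 v = vcol G2 v' \<and> \<delta> \<in> carrier (?\<Delta> v) \<and> n < m (vcol G1 v)}"
  \<comment> \<open>The copy number \<open>n\<close> does not enter: all copies of a triple carry
    the same star map.\<close>
  define \<phi> where "\<phi> = (\<lambda>(v, v', \<delta>, n :: nat) e. sact G2 v' \<delta> (F v v' e))"
  define p :: "'v1 \<times> 'v2 \<times> 'd \<times> nat \<Rightarrow> 'v1" where "p = fst"
  define p' :: "'v1 \<times> 'v2 \<times> 'd \<times> nat \<Rightarrow> 'v2" where "p' = fst \<circ> snd"
  have X: "p x \<in> verts (dg G1)" "p' x \<in> verts (dg G2)" "vcol G1 (p x) = vcol G2 (p' x)" if "x \<in> X" for x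
    using that by (auto simp: X_def p_def p'_def)
  have "finite X"
  proof (rule finite_subset)
    show "X \<subseteq> Sigma (verts (dg G1)) (\<lambda>v. verts (dg G2) \<times> carrier (?\<Delta> v) \<times> {..<m (vcol G1 v)})"
      by (auto simp: X_def)
  qed (auto intro!: finite_SigmaI grp)
  have act2: "group_action (?\<Delta> (p x)) (star G2 (p' x)) (sact G2 (p' x))" if "x \<in> X" for x
    using sr_graph_group_action[OF G2 X(2)[OF that]] by (simp only: X(3)[OF that])
  have \<phi>_eq: "\<exists>\<delta> \<in> carrier (?\<Delta> (p x)). \<phi> x = sact G2 (p' x) \<delta> \<circ> F (p x) (p' x)" if "x \<in> X" for x
    using that
    by (intro bexI[of _ "fst (snd (snd x))"]) (auto simp: X_def \<phi>_def p_def p'_def)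
  have \<phi>_bij: "bij_betw (\<phi> x) (star G1 (p x)) (star G2 (p' x))" if x: "x \<in> X" for x
  proof -
    obtain \<delta> where \<delta>: "\<delta> \<in> carrier (?\<Delta> (p x))" "\<phi> x = sact G2 (p' x) \<delta> \<circ> F (p x) (p' x)"
      using \<phi>_eq[OF x] by blast
    have "bij_betw (sact G2 (p' x) \<delta>) (star G2 (p' x)) (star G2 (p' x))"
      using group_action.bij_prop0[OF act2[OF x] \<delta>(1)] by (simp add: Bij_def)
    then show ?thesis unfolding \<delta>(2) by (rule bij_betw_trans[OF F_bij[OF X[OF x]]])
  qed
  have \<phi>_col: "ecol G2 (\<phi> x e) = ecol G1 e" if x: "x \<in> X" and e: "e \<in> star G1 (p x)" for x e
  proof -
    obtain \<delta> where \<delta>: "\<delta> \<in> carrier (?\<Delta> (p x))" "\<phi> x = sact G2 (p' x) \<delta> \<circ> F (p x) (p' x)"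
      using \<phi>_eq[OF x] by blast
    have "F (p x) (p' x) e \<in> star G2 (p' x)" using bij_betwE[OF F_bij[OF X[OF x]]] e by blast
    from ecol_sact[OF D G2 X(2)[OF x] _ this] show ?thesis
      using \<delta> X(3)[OF x] F_col[OF X[OF x] e] by simp
  qed
  have \<phi>_equi: "weakly_equivariant (?\<Delta> (p x)) (star G1 (p x)) (sact G1 (p x)) (sact G2 (p' x)) (\<phi> x)"
    if x: "x \<in> X" for x
  proof -
    interpret group "?\<Delta> (p x)" using grp X[OF x] by blast
    interpret act: group_action "?\<Delta> (p x)" "star G2 (p' x)" "sact G2 (p' x)" by (rule act2[OF x])
    obtain \<gamma> where \<gamma>: "\<gamma> \<in> carrier (?\<Delta> (p x))" "\<phi> x = sact G2 (p' x) \<gamma> \<circ> F (p x) (p' x)"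
      using \<phi>_eq[OF x] by blast
    \<comment> \<open>The element \<open>\<gamma>\<close> by which \<open>\<phi> x\<close> differs
      from the strictly equivariant map \<open>F\<close> is itself the conjugator: moving it past
      \<open>\<delta>\<close> replaces \<open>\<delta>\<close> by its conjugate.\<close>
    show ?thesis unfolding weakly_equivariant_def
    proof (intro bexI[OF _ \<gamma>(1)] ballI)
      fix e \<delta> assume e: "e \<in> star G1 (p x)" and \<delta>: "\<delta> \<in> carrier (?\<Delta> (p x))"
      let ?e = "F (p x) (p' x) e"
      have Fe: "?e \<in> star G2 (p' x)" using bij_betwE[OF F_bij[OF X[OF x]]] e by blast
      have "\<phi> x (sact G1 (p x) \<delta> e) = sact G2 (p' x) \<gamma> (sact G2 (p' x) \<delta> ?e)"
        using F_equi[OF X[OF x] \<delta> e] by (simp add: \<gamma>(2))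
      also have "\<dots> = sact G2 (p' x) (\<gamma> \<otimes>\<^bsub>?\<Delta> (p x)\<^esub> \<delta>) ?e"
        using act.composition_rule[OF Fe] \<gamma>(1) \<delta> by simp
      also have "\<gamma> \<otimes>\<^bsub>?\<Delta> (p x)\<^esub> \<delta> =
          \<gamma> \<otimes>\<^bsub>?\<Delta> (p x)\<^esub> \<delta> \<otimes>\<^bsub>?\<Delta> (p x)\<^esub> inv\<^bsub>?\<Delta> (p x)\<^esub> \<gamma> \<otimes>\<^bsub>?\<Delta> (p x)\<^esub> \<gamma>"
        using \<gamma>(1) \<delta> by (simp add: m_assoc)
      also have "sact G2 (p' x) \<dots> ?e =
          sact G2 (p' x) (\<gamma> \<otimes>\<^bsub>?\<Delta> (p x)\<^esub> \<delta> \<otimes>\<^bsub>?\<Delta> (p x)\<^esub> inv\<^bsub>?\<Delta> (p x)\<^esub> \<gamma>) (\<phi> x e)"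
        using act.composition_rule[OF Fe] \<gamma> \<delta> by simp
      finally show "\<phi> x (sact G1 (p x) \<delta> e) =
          sact G2 (p' x) (\<gamma> \<otimes>\<^bsub>?\<Delta> (p x)\<^esub> \<delta> \<otimes>\<^bsub>?\<Delta> (p x)\<^esub> inv\<^bsub>?\<Delta> (p x)\<^esub> \<gamma>) (\<phi> x e)" .
    qed
  qed

  define S where "S e e' = {x \<in> X. p x = tail (dg G1) e \<and> p' x = tail (dg G2) e' \<and> \<phi> x e = e'}" for e e'
  \<comment> \<open>The arcs \<open>e\<close> and \<open>e'\<close> fix the first two components of
    \<open>x\<close>. The third ranges over the elements taking \<open>F ?v ?v' e\<close> to
    \<open>e'\<close>, as many as the stabilizer has, and the fourth over the copies. For different
    colors nothing remains, since \<open>\<phi> x\<close> preserves colors.\<close>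
  have card_S: "card (S e e') =
      (if ecol G1 e = ecol G2 e' then w (ecol G1 e) * m (vcol G1 (tail (dg G1) e)) else 0)"
    if e: "e \<in> arcs (dg G1)" and e': "e' \<in> arcs (dg G2)" for e e'
  proof (cases "ecol G1 e = ecol G2 e'")
    case True
    let ?v = "tail (dg G1) e" and ?v' = "tail (dg G2) e'"
    have v: "?v \<in> verts (dg G1)" "?v' \<in> verts (dg G2)" "vcol G1 ?v = vcol G2 ?v'"
      using e e' by (simp_all add: bar1 bar2 True)
    have Fe: "F ?v ?v' e \<in> star G2 ?v'" using bij_betwE[OF F_bij[OF v]] e by auto
    let ?T = "{\<delta> \<in> carrier (grp D (vcol G2 ?v')). sact G2 ?v' \<delta> (F ?v ?v' e) = e'}"
    have "S e e' = {?v} \<times> {?v'} \<times> ?T \<times> {..<m (vcol G1 ?v)}"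
      using v by (auto simp: S_def X_def \<phi>_def p_def p'_def)
    moreover have "card ?T = w (ecol G2 e')"
      using card_star_transporter[OF D stabs G2 v(2) Fe, of e'] F_col[OF v, of e] e e' True
      by (simp add: w_def)
    ultimately show ?thesis using True by (simp add: card_cartesian_product)
  next
    case False
    then have "S e e' = {}" using \<phi>_col e by (auto simp: S_def)
    then show ?thesis using False by simp
  qed
  \<comment> \<open>Reversal is injective on the edge-colors, so both sides vanish together;
    otherwise the claim is the balance of the multiplicities along \<open>e\<close>.\<close>
  have balanced: "card (S e e') = card (S (bar G1 e) (bar G2 e'))"
    if e: "e \<in> arcs (dg G1)" and e': "e' \<in> arcs (dg G2)" for e e'
  proof -
    have "bar C (ecol G1 e) = bar C (ecol G2 e') \<longleftrightarrow> ecol G1 e = ecol G2 e'"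
      using bar1(5)[OF e] bar2(4)[OF e'] inv(1) by (metis involutive_graph_def)
    then show ?thesis
      using m[OF e] by (cases "ecol G1 e = ecol G2 e'")
        (simp_all add: card_S e e' bar1(1,4) bar2(1,3) mult.commute)
  qed
  obtain K :: "('v1 \<times> 'v2 \<times> 'd \<times> nat, 'e1 \<times> 'e2 \<times> nat) igraph"
    where K: "involutive_graph K" "fin_digraph (dg K)" "verts (dg K) = X"
      "graph_hom K G1 p fst" "graph_hom K G2 p' (fst \<circ> snd)"
      "\<And>x. x \<in> X \<Longrightarrow> bij_betw fst (star K x) (star G1 (p x))"
      "\<And>x a. \<lbrakk>x \<in> X; a \<in> star K x\<rbrakk> \<Longrightarrow> fst (snd a) = \<phi> x (fst a)"
  proof (rule fibre_product_graph[of G1 G2 X p p' \<phi>])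
    show "\<phi> x e \<in> star G2 (p' x)" if "x \<in> X" "e \<in> star G1 (p x)" for x e
      using bij_betwE[OF \<phi>_bij[OF that(1)]] that(2) by blast
  qed (use inv assms(6,8) X balanced \<open>finite X\<close> in \<open>auto simp: S_def\<close>)
  obtain fv fe fv' fe' where cov: "sr_morphism D H G1 fv fe" "sr_morphism D H G2 fv' fe'"
    using assms(10,11) by (auto simp: sr_covers_def)
  have "verts (dg H) \<noteq> {}"
    using assms(9) by (simp add: is_sr_graph_def ordinary_graph_def color_graph_def
        Digraph_Component.connected_def strongly_connected_def)
  then obtain u where u: "u \<in> verts (dg H)" by blast
  have v: "fv u \<in> verts (dg G1)" "fv' u \<in> verts (dg G2)" "vcol G1 (fv u) = vcol G2 (fv' u)"
    using cov u by (auto simp: sr_morphism_def graph_hom_def)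
  \<comment> \<open>The images of one vertex of the common covering have equal colors, and copy
    number 0 exists because multiplicities are positive. The component of this vertex becomes the
    covering.\<close>
  have "(fv u, fv' u, \<one>\<^bsub>?\<Delta> (fv u)\<^esub>, 0) \<in> X"
    using v m_pos[OF v(1)] monoid.one_closed[OF group.is_monoid[OF grp(1)[OF v(1)]]]
    by (simp add: X_def)
  then obtain L :: "(nat, nat) igraph" and f g
    where L: "color_graph L" "fin_digraph (dg L)" "graph_hom L K f g"
      "\<And>y. y \<in> verts (dg L) \<Longrightarrow> bij_betw g (star L y) (star K (f y))"
    using finite_component_on_nat[OF K(1,2)] K(3) by metis
  have fX: "f y \<in> X" if "y \<in> verts (dg L)" for y
    using that L(3) K(3) by (auto simp: graph_hom_def)
  have homL1: "graph_hom L G1 (p \<circ> f) (fst \<circ> g)"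
    and homL2: "graph_hom L G2 (p' \<circ> f) (fst \<circ> snd \<circ> g)"
    using graph_hom_comp[OF L(3) K(4)] graph_hom_comp[OF L(3) K(5)] by simp_all
  have bijL: "bij_betw (fst \<circ> g) (star L y) (star G1 ((p \<circ> f) y))" if "y \<in> verts (dg L)" for y
    using bij_betw_trans[OF L(4)[OF that] K(6)[OF fX[OF that]]] by simp
  have \<phi>L: "(fst \<circ> snd \<circ> g) a = \<phi> (f y) ((fst \<circ> g) a)" if "y \<in> verts (dg L)" "a \<in> star L y" for y a
    using K(7)[OF fX[OF that(1)]] bij_betwE[OF L(4)[OF that(1)]] that(2) by simp
  interpret L: wf_digraph "dg L" using L(1) by (simp add: color_graph_def)
  \<comment> \<open>The structure comes from \<open>G1\<close>, so the map to \<open>G1\<close> is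
    equivariant with the identity as conjugator, while the map to \<open>G2\<close> takes its
    conjugator from \<open>\<phi> (f y)\<close>.\<close>
  let ?P = "sr_pullback L (p \<circ> f) (fst \<circ> g) G1"
  have "is_sr_graph C D ?P" by (rule is_sr_graph_pullback[OF G1 L(1) homL1 bijL])
  moreover have "fin_digraph (dg ?P)" using L(2) by (simp add: sr_pullback_def)
  moreover have "sr_morphism D ?P G1 (p \<circ> f) (fst \<circ> g)"
  proof (rule sr_morphism_pullback[OF G1 homL1 bijL homL1, where \<phi> = "\<lambda>_ e. e"])
    fix y assume y: "y \<in> verts (dg L)"
    interpret group "?\<Delta> (p (f y))" using grp X(1)[OF fX[OF y]] by simp
    show "weakly_equivariant (?\<Delta> ((p \<circ> f) y)) (star G1 ((p \<circ> f) y)) (sact G1 ((p \<circ> f) y))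
        (sact G1 ((p \<circ> f) y)) (\<lambda>e. e)"
      unfolding weakly_equivariant_def
      by (intro bexI[of _ "\<one>\<^bsub>?\<Delta> ((p \<circ> f) y)\<^esub>"]) simp_all
  qed (auto simp: bij_betw_def)
  moreover have "sr_morphism D ?P G2 (p' \<circ> f) (fst \<circ> snd \<circ> g)"
  proof (rule sr_morphism_pullback[OF G1 homL1 bijL homL2, where \<phi> = "\<lambda>y. \<phi> (f y)"])
    fix a assume a: "a \<in> arcs (dg L)"
    then have y: "tail (dg L) a \<in> verts (dg L)" "a \<in> star L (tail (dg L) a)" by simp_all
    have "(fst \<circ> g) a \<in> star G1 (p (f (tail (dg L) a)))"
      using bij_betwE[OF bijL[OF y(1)]] y(2) by simp
    then show "ecol G2 ((fst \<circ> snd \<circ> g) a) = ecol G1 ((fst \<circ> g) a)"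
      unfolding \<phi>L[OF y] by (rule \<phi>_col[OF fX[OF y(1)]])
  qed (use fX X \<phi>_bij \<phi>_equi \<phi>L in simp_all)
  ultimately show ?thesis by (auto simp: sr_covers_def)
qed

end
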